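(* Let $m\ge1$ and, for $\ell=1,\dots,m$, let $\mathbf p_{r_\ell}$ be an $r_\ell\times r_\ell$ matrix-valued trigonometric polynomial in one variable such that $$\mathbf p_{r_\ell}(\theta)^H\mathbf p_{r_\ell}(\theta)+\mathbf p_{r_\ell}(\theta+\pi)^H\mathbf p_{r_\ell}(\theta+\pi)>0\quad\text{for all }\theta\in[0,2\pi).$$ Let $\mathbf p^{(m)}_{\mathbf r}(\theta_1,\dots,\theta_m)=\bigotimes_{\ell=1}^m\mathbf p_{r_\ell}(\theta_\ell)$. Then $$\sum_{\xi\in\Omega(\boldsymbol\theta)}\mathbf p^{(m)}_{\mathbf r}(\xi)^H\mathbf p^{(m)}_{\mathbf r}(\xi)>0\quad\text{for all }\boldsymbol\theta\in[0,2\pi)^m .$$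
   Context: $\otimes$ is the Kronecker product, $X^H$ the conjugate transpose, and $X>0$ means $X$ is Hermitian positive definite. For $\boldsymbol\theta=(\theta_1,\dots,\theta_m)$, $\Omega(\boldsymbol\theta)=\{\boldsymbol\theta+\pi\boldsymbol\eta:\ \boldsymbol\eta\in\{0,1\}^m\}$. *)

theory Defs
  imports "Jordan_Normal_Form.Schur_Decomposition"
begin

(* The matrix counterpart of finsum_vec. As with every finprod, the summands have to lie in the
   carrier, i.e. be n x n matrices, and the index set has to be finite. *)
definition finsum_mat :: "nat \<Rightarrow> ('i \<Rightarrow> complex mat) \<Rightarrow> 'i set \<Rightarrow> complex mat" where
  "finsum_mat n = finprod (monoid_mat TYPE(complex) n n)"

definition matrix_trig_poly :: "nat \<Rightarrow> (real \<Rightarrow> complex mat) \<Rightarrow> bool" where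
  "matrix_trig_poly r p \<longleftrightarrow>
     (\<exists>(c::nat) (a :: int \<Rightarrow> complex mat).
        (\<forall>k. a k \<in> carrier_mat r r) \<and>
        (\<forall>\<theta>. p \<theta> = finsum_mat r (\<lambda>k. cis (of_int k * \<theta>) \<cdot>\<^sub>m a k) {- int c..int c}))"

(* (A *\<^sub>v v) \<bullet>c v is v^H A v, and 0 < z on complex means that z is real and positive.
   The relation 0 < A that the library defines on matrices is the entrywise order, hence a
   separate predicate. *)
definition pos_def_mat :: "complex mat \<Rightarrow> bool" where
  "pos_def_mat A \<longleftrightarrow>
     square_mat A \<and> mat_adjoint A = A \<and>
     (\<forall>v \<in> carrier_vec (dim_row A). v \<noteq> 0\<^sub>v (dim_row A) \<longrightarrow> 0 < (A *\<^sub>v v) \<bullet>c v)"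

definition kronecker :: "complex mat \<Rightarrow> complex mat \<Rightarrow> complex mat" where
  "kronecker A B = mat (dim_row A * dim_row B) (dim_col A * dim_col B)
     (\<lambda>(i, j). A $$ (i div dim_row B, j div dim_col B) * B $$ (i mod dim_row B, j mod dim_col B))"

(* The Kronecker product of A 0, ..., A (m - 1) in this order; the 1 x 1 identity of the base
   case is its neutral element. *)
primrec kronecker_prod :: "nat \<Rightarrow> (nat \<Rightarrow> complex mat) \<Rightarrow> complex mat" where
  "kronecker_prod 0 A = 1\<^sub>m 1"
| "kronecker_prod (Suc m) A = kronecker (kronecker_prod m A) (A m)"

(* Coordinates are numbered from 0: p l is the factor in the variable \<theta> $ l, for l < m. *)
definition multi_symbol :: "nat \<Rightarrow> (nat \<Rightarrow> real \<Rightarrow> complex mat) \<Rightarrow> real vec \<Rightarrow> complex mat" where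
  "multi_symbol m p \<theta> = kronecker_prod m (\<lambda>l. p l (\<theta> $ l))"

definition mirror_points :: "real vec \<Rightarrow> real vec set" where
  "mirror_points \<theta> =
     {\<theta> + pi \<cdot>\<^sub>v \<eta> | \<eta>. \<eta> \<in> carrier_vec (dim_vec \<theta>) \<and> (\<forall>l < dim_vec \<theta>. \<eta> $ l \<in> {0, 1})}"

end

theory Submission
  imports Defs
begin

text \<open>
  The sum over the mirror points need not be factorized. The quadratic form of
  \<open>\<Sum>\<^sub>\<xi> P(\<xi>)\<^sup>H P(\<xi>)\<close> at \<open>v\<close> is \<open>\<Sum>\<^sub>\<xi> |P(\<xi>) v|\<^sup>2\<close>, so it suffices to find, for each
  \<open>v \<noteq> 0\<close>, one mirror point \<open>\<xi>\<close> with \<open>P(\<xi>) v \<noteq> 0\<close>. Reshaping \<open>v\<close> as a matrix \<open>V\<close> turns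
  \<open>(A \<otimes> B) v\<close> into \<open>A V B\<^sup>T\<close>: a nonzero row of \<open>V\<close> survives one of the two choices of the last
  factor, and a nonzero column of the result survives some choice of the others by induction.
\<close>

section \<open>Adjoints and Gram matrices\<close>

lemma dim_mat_adjoint [simp]:
  "dim_row (mat_adjoint A) = dim_col A" "dim_col (mat_adjoint A) = dim_row A"
  by (simp_all add: mat_adjoint_def)

lemma mat_adjoint_carrier [simp]:
  "A \<in> carrier_mat n k \<Longrightarrow> mat_adjoint A \<in> carrier_mat k n"
  by auto

lemma index_mat_adjoint:
  "A \<in> carrier_mat n k \<Longrightarrow> i < k \<Longrightarrow> j < n \<Longrightarrow> mat_adjoint A $$ (i, j) = conjugate (A $$ (j, i))"
  by (simp add: mat_adjoint_def mat_of_rows_index)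

text \<open>As \<open>\<bullet>c\<close> conjugates its second argument, both sides expand to the
  same double sum over the entries of \<open>A\<close>, up to the order of summation.\<close>

lemma cscalar_prod_mat_adjoint:
  fixes A :: "'a :: conjugatable_field mat"
  assumes A: "A \<in> carrier_mat n k" and v: "v \<in> carrier_vec n" and w: "w \<in> carrier_vec k"
  shows "(mat_adjoint A *\<^sub>v v) \<bullet>c w = v \<bullet>c (A *\<^sub>v w)"
proof -
  have "(mat_adjoint A *\<^sub>v v) \<bullet>c w =
      (\<Sum>i = 0..<k. \<Sum>j = 0..<n. conjugate (A $$ (j, i)) * v $ j * conjugate (w $ i))"
    using A v w mat_adjoint_carrier[OF A]
    by (simp add: scalar_prod_def index_mat_adjoint[OF A] sum_distrib_right)
  also have "\<dots> = (\<Sum>j = 0..<n. \<Sum>i = 0..<k. conjugate (A $$ (j, i)) * v $ j * conjugate (w $ i))"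
    by (rule sum.swap)
  also have "\<dots> = v \<bullet>c (A *\<^sub>v w)"
    using A v w
    by (simp add: scalar_prod_def sum_conjugate sum_distrib_left conjugate_dist_mul mult_ac)
  finally show ?thesis .
qed

text \<open>Moving the adjoint across the inner product leaves the squared norm of
  \<open>A *\<^sub>v v\<close>.\<close>

lemma gram_quadratic_form:
  fixes A :: "'a :: conjugatable_field mat"
  assumes A: "A \<in> carrier_mat n k" and v: "v \<in> carrier_vec k"
  shows "((mat_adjoint A * A) *\<^sub>v v) \<bullet>c v = (A *\<^sub>v v) \<bullet>c (A *\<^sub>v v)"
  using cscalar_prod_mat_adjoint[OF A, of "A *\<^sub>v v" v] A v mat_adjoint_carrier[OF A]
  by (simp add: assoc_mult_mat_vec[of _ k n _ k])

lemma mat_adjoint_gram: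
  fixes A :: "'a :: conjugatable_field mat"
  assumes A: "A \<in> carrier_mat n k"
  shows "mat_adjoint (mat_adjoint A * A) = mat_adjoint A * A"
proof -
  note A' = mat_adjoint_carrier[OF A]
  have AA: "mat_adjoint A * A \<in> carrier_mat k k" using mult_carrier_mat[OF A' A] .
  show ?thesis
    using AA mat_adjoint_carrier[OF AA] A A'
    by (intro eq_matI)
       (auto simp: index_mat_adjoint[OF AA] index_mat_adjoint[OF A] scalar_prod_def sum_conjugate
          conjugate_dist_mul mult_ac intro!: sum.cong)
qed

lemma mat_adjoint_add:
  fixes A B :: "'a :: conjugatable_field mat"
  assumes A: "A \<in> carrier_mat n k" and B: "B \<in> carrier_mat n k"
  shows "mat_adjoint (A + B) = mat_adjoint A + mat_adjoint B"
proof -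
  have AB: "A + B \<in> carrier_mat n k" using A B by simp
  show ?thesis
    using A B mat_adjoint_carrier[OF AB] mat_adjoint_carrier[OF A] mat_adjoint_carrier[OF B]
    by (intro eq_matI)
       (auto simp: index_mat_adjoint[OF AB] index_mat_adjoint[OF A] index_mat_adjoint[OF B]
          conjugate_dist_add)
qed

section \<open>Finite sums of square matrices\<close>

lemma finsum_mat_empty: "finsum_mat n f {} = 0\<^sub>m n n"
  using comm_monoid.finprod_empty[OF comm_monoid_mat, of n n f]
  by (simp add: finsum_mat_def monoid_mat_def)

lemma finsum_mat_closed:
  "f \<in> S \<rightarrow> carrier_mat n n \<Longrightarrow> finsum_mat n f S \<in> carrier_mat n n"
  using comm_monoid.finprod_closed[OF comm_monoid_mat, of f S n n]
  by (simp add: finsum_mat_def monoid_mat_def)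

lemma finsum_mat_insert:
  "finite S \<Longrightarrow> i \<notin> S \<Longrightarrow> f \<in> S \<rightarrow> carrier_mat n n \<Longrightarrow> f i \<in> carrier_mat n n \<Longrightarrow>
    finsum_mat n f (insert i S) = f i + finsum_mat n f S"
  using comm_monoid.finprod_insert[OF comm_monoid_mat, of S i f n n]
  by (simp add: finsum_mat_def monoid_mat_def)

lemma finsum_mat_quadratic_form:
  assumes "finite S" and "\<And>i. i \<in> S \<Longrightarrow> f i \<in> carrier_mat n n" and v: "v \<in> carrier_vec n"
  shows "(finsum_mat n f S *\<^sub>v v) \<bullet>c v = (\<Sum>i\<in>S. (f i *\<^sub>v v) \<bullet>c v)"
  using assms(1,2)
proof (induction S)
  case empty
  then show ?case using v by (simp add: finsum_mat_empty scalar_prod_def)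
next
  case (insert i S)
  have f: "f \<in> S \<rightarrow> carrier_mat n n" "f i \<in> carrier_mat n n" using insert by auto
  have c: "finsum_mat n f S \<in> carrier_mat n n" using f by (intro finsum_mat_closed)
  show ?case
    using insert f c v
      add_scalar_prod_distrib[OF mult_mat_vec_carrier[OF f(2) v] mult_mat_vec_carrier[OF c v],
        of "conjugate v"]
    by (simp add: finsum_mat_insert add_mult_distrib_mat_vec[of _ n n])
qed

lemma mat_adjoint_finsum_mat:
  assumes "finite S" and "\<And>i. i \<in> S \<Longrightarrow> f i \<in> carrier_mat n n"
    and "\<And>i. i \<in> S \<Longrightarrow> mat_adjoint (f i) = f i"
  shows "mat_adjoint (finsum_mat n f S) = finsum_mat n f S"
  using assms
proof (induction S)
  case empty
  then show ?case
    using mat_adjoint_carrier[of "0\<^sub>m n n" n n]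
    by (intro eq_matI) (auto simp: finsum_mat_empty index_mat_adjoint[of _ n n])
next
  case (insert i S)
  have f: "f \<in> S \<rightarrow> carrier_mat n n" "f i \<in> carrier_mat n n" using insert by auto
  have c: "finsum_mat n f S \<in> carrier_mat n n" using f by (intro finsum_mat_closed)
  show ?case
    using insert f c by (simp add: finsum_mat_insert mat_adjoint_add[of _ n n])
qed

section \<open>Positive definiteness and common kernels of Gram sums\<close>

text \<open>The form at \<open>v\<close> is a sum of squared norms: all are nonnegative, and the
  index supplied by \<open>inj\<close> contributes a positive one. The index may depend on
  \<open>v\<close>, so no single \<open>P i\<close> has to be invertible.\<close>

lemma pos_def_finsum_gram:
  assumes fin: "finite S" and P: "\<And>i. i \<in> S \<Longrightarrow> P i \<in> carrier_mat n n"
    and inj: "\<And>v. v \<in> carrier_vec n \<Longrightarrow> v \<noteq> 0\<^sub>v n \<Longrightarrow> \<exists>i\<in>S. P i *\<^sub>v v \<noteq> 0\<^sub>v n"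
  shows "pos_def_mat (finsum_mat n (\<lambda>i. mat_adjoint (P i) * P i) S)"
proof -
  let ?G = "\<lambda>i. mat_adjoint (P i) * P i"
  have G: "?G i \<in> carrier_mat n n" if "i \<in> S" for i
    using mult_carrier_mat[OF mat_adjoint_carrier[OF P[OF that]] P[OF that]] .
  have c: "finsum_mat n ?G S \<in> carrier_mat n n"
    using G by (intro finsum_mat_closed) auto
  have "0 < (finsum_mat n ?G S *\<^sub>v v) \<bullet>c v" if v: "v \<in> carrier_vec n" "v \<noteq> 0\<^sub>v n" for v
  proof -
    obtain i where i: "i \<in> S" "P i *\<^sub>v v \<noteq> 0\<^sub>v n" using inj v by blast
    have Pv: "P j *\<^sub>v v \<in> carrier_vec n" if "j \<in> S" for j
      using P[OF that] v by simp
    have "(finsum_mat n ?G S *\<^sub>v v) \<bullet>c v = (\<Sum>j\<in>S. (?G j *\<^sub>v v) \<bullet>c v)"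
      using fin G v(1) by (rule finsum_mat_quadratic_form)
    also have "\<dots> = (\<Sum>j\<in>S. (P j *\<^sub>v v) \<bullet>c (P j *\<^sub>v v))"
      using gram_quadratic_form[OF P v(1)] by simp
    also have "\<dots> > 0"
      using fin i(1)
    proof (rule sum_pos2)
      show "0 < (P i *\<^sub>v v) \<bullet>c (P i *\<^sub>v v)"
        using conjugate_square_greater_0_vec[OF Pv[OF i(1)]] i(2) by simp
    qed (rule conjugate_square_ge_0_vec)
    finally show ?thesis .
  qed
  moreover have "mat_adjoint (finsum_mat n ?G S) = finsum_mat n ?G S"
    using fin G mat_adjoint_gram[OF P] by (rule mat_adjoint_finsum_mat)
  ultimately show ?thesis using c by (auto simp: pos_def_mat_def)
qed

text \<open>The converse direction for two summands, which extracts the usable content of the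
  hypothesis on each factor: a common kernel vector would make the form vanish.\<close>

lemma pos_def_gram_add_inj:
  assumes "pos_def_mat (mat_adjoint A * A + mat_adjoint B * B)"
    and A: "A \<in> carrier_mat k n" and B: "B \<in> carrier_mat k n"
    and v: "v \<in> carrier_vec n" "v \<noteq> 0\<^sub>v n"
  shows "A *\<^sub>v v \<noteq> 0\<^sub>v k \<or> B *\<^sub>v v \<noteq> 0\<^sub>v k"
proof (rule ccontr)
  assume "\<not> ?thesis"
  then have "(A *\<^sub>v v) \<bullet>c (A *\<^sub>v v) + (B *\<^sub>v v) \<bullet>c (B *\<^sub>v v) = 0" by simp
  moreover have AA: "mat_adjoint A * A \<in> carrier_mat n n" and BB: "mat_adjoint B * B \<in> carrier_mat n n"
    using mult_carrier_mat[OF mat_adjoint_carrier] A B by blast+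
  then have "((mat_adjoint A * A + mat_adjoint B * B) *\<^sub>v v) \<bullet>c v =
      (A *\<^sub>v v) \<bullet>c (A *\<^sub>v v) + (B *\<^sub>v v) \<bullet>c (B *\<^sub>v v)"
    using v by (simp add: add_mult_distrib_mat_vec[OF AA BB] add_scalar_prod_distrib[of _ n]
        gram_quadratic_form[OF A] gram_quadratic_form[OF B])
  moreover have "0 < ((mat_adjoint A * A + mat_adjoint B * B) *\<^sub>v v) \<bullet>c v"
    using assms(1) v AA BB by (auto simp: pos_def_mat_def)
  ultimately show False by simp
qed

section \<open>Kronecker products acting on vectors\<close>

lemma kronecker_carrier [simp]:
  "A \<in> carrier_mat n n' \<Longrightarrow> B \<in> carrier_mat k k' \<Longrightarrow>
    kronecker A B \<in> carrier_mat (n * k) (n' * k')"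
  by (auto simp: kronecker_def)

text \<open>The range is cut into \<open>n\<close> blocks of length \<open>k\<close>; block number
  and offset are the quotient and remainder by which \<open>kronecker\<close> indexes its
  entries.\<close>

lemma sum_lessThan_mult:
  fixes f :: "nat \<Rightarrow> 'a :: comm_monoid_add"
  shows "(\<Sum>c = 0..<n * k. f c) = (\<Sum>a = 0..<n. \<Sum>b = 0..<k. f (a * k + b))"
proof -
  have "(\<Sum>a<n. sum f {a * k..<a * k + k}) = sum f {..<n * k}"
    by (rule sum.nat_group)
  moreover have "sum f {a * k..<a * k + k} = (\<Sum>b = 0..<k. f (a * k + b))" for a
    using sum.shift_bounds_nat_ivl[of f 0 "a * k" k] by (simp add: add.commute)
  ultimately show ?thesis by (simp add: atLeast0LessThan)
qed

lemma mult_add_less: "i < n \<Longrightarrow> j < k \<Longrightarrow> i * k + j < n * (k :: nat)"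
  using mult_le_mono1[of "Suc i" n k] by simp

text \<open>The entry \<open>(i, j)\<close> of \<open>A V B\<^sup>T\<close>, where \<open>V\<close> has the entries \<open>v $ (a * k' + b)\<close>.\<close>

lemma index_kronecker_mult_vec:
  assumes A: "A \<in> carrier_mat n n'" and B: "B \<in> carrier_mat k k'"
    and v: "v \<in> carrier_vec (n' * k')" and i: "i < n" and j: "j < k"
  shows "(kronecker A B *\<^sub>v v) $ (i * k + j) =
    (A *\<^sub>v vec n' (\<lambda>a. (B *\<^sub>v vec k' (\<lambda>b. v $ (a * k' + b))) $ j)) $ i"
proof -
  note ij = mult_add_less[OF i j]
  have K: "kronecker A B $$ (i * k + j, a * k' + b) = A $$ (i, a) * B $$ (j, b)"
    if "a < n'" "b < k'" for a b
    using A B j ij mult_add_less[OF that] that by (simp add: kronecker_def)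
  have "(kronecker A B *\<^sub>v v) $ (i * k + j) =
      (\<Sum>c = 0..<n' * k'. kronecker A B $$ (i * k + j, c) * v $ c)"
    using kronecker_carrier[OF A B] v ij by (simp add: scalar_prod_def)
  also have "\<dots> = (\<Sum>a = 0..<n'. \<Sum>b = 0..<k'. A $$ (i, a) * (B $$ (j, b) * v $ (a * k' + b)))"
    by (simp add: sum_lessThan_mult K mult.assoc)
  also have "\<dots> = (A *\<^sub>v vec n' (\<lambda>a. (B *\<^sub>v vec k' (\<lambda>b. v $ (a * k' + b))) $ j)) $ i"
    using A B i j by (simp add: scalar_prod_def sum_distrib_left)
  finally show ?thesis .
qed

lemma nonzero_vec_index:
  assumes "v \<in> carrier_vec n" "v \<noteq> 0\<^sub>v n"
  obtains i where "i < n" "v $ i \<noteq> 0"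
  using assms by (metis carrier_vecD eq_vecI index_zero_vec)

lemma kronecker_prod_carrier:
  "(\<And>l. l < m \<Longrightarrow> A l \<in> carrier_mat (r l) (r l)) \<Longrightarrow>
    kronecker_prod m A \<in> carrier_mat (\<Prod>l<m. r l) (\<Prod>l<m. r l)"
  by (induction m) auto

lemma kronecker_prod_cong:
  "(\<And>l. l < m \<Longrightarrow> A l = B l) \<Longrightarrow> kronecker_prod m A = kronecker_prod m B"
  by (induction m) auto

text \<open>\<open>F l\<close> holds the candidates for factor \<open>l\<close>, and no nonzero
  vector is killed by all of them. The factors are chosen from the last to the first, each depending
  on the vector left by the previous choices; hence the induction generalizes
  \<open>v\<close>.\<close>

lemma kronecker_prod_choice_nonzero:
  assumes "\<And>l A. l < m \<Longrightarrow> A \<in> F l \<Longrightarrow> A \<in> carrier_mat (r l) (r l)"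
    and "\<And>l v. l < m \<Longrightarrow> v \<in> carrier_vec (r l) \<Longrightarrow> v \<noteq> 0\<^sub>v (r l) \<Longrightarrow>
           \<exists>A\<in>F l. A *\<^sub>v v \<noteq> 0\<^sub>v (r l)"
    and "v \<in> carrier_vec (\<Prod>l<m. r l)" "v \<noteq> 0\<^sub>v (\<Prod>l<m. r l)"
  shows "\<exists>S. (\<forall>l<m. S l \<in> F l) \<and> kronecker_prod m S *\<^sub>v v \<noteq> 0\<^sub>v (\<Prod>l<m. r l)"
  using assms
proof (induction m arbitrary: v)
  \<comment> \<open>The empty product is the identity of size 1, so any \<open>S\<close> will
    do.\<close>
  case 0
  then show ?case by auto
next
  case (Suc m)
  let ?n = "\<Prod>l<m. r l" and ?k = "r m"
  have v: "v \<in> carrier_vec (?n * ?k)" using Suc.prems(3) by simp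
  obtain c where c: "c < ?n * ?k" "v $ c \<noteq> 0"
    using nonzero_vec_index Suc.prems(3,4) by (metis prod.lessThan_Suc)
  \<comment> \<open>The rows of the reshaped matrix \<open>V\<close>; the nonzero entry
    \<open>v $ c\<close> lies in row \<open>c div ?k\<close>.\<close>
  define row where "row = (\<lambda>a. vec ?k (\<lambda>b. v $ (a * ?k + b)))"
  have k: "0 < ?k" using c(1) by (cases "?k = 0") auto
  have a: "c div ?k < ?n" using c(1) by (simp add: less_mult_imp_div_less)
  have "row (c div ?k) $ (c mod ?k) \<noteq> 0" using c(2) k by (simp add: row_def)
  then have "row (c div ?k) \<noteq> 0\<^sub>v ?k" using k by auto
  moreover have row: "row a \<in> carrier_vec ?k" for a by (simp add: row_def)
  ultimately obtain B where B: "B \<in> F m" "B *\<^sub>v row (c div ?k) \<noteq> 0\<^sub>v ?k"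
    using Suc.prems(2) by blast
  have Bc: "B \<in> carrier_mat ?k ?k" using B(1) Suc.prems(1) by blast
  obtain j where j: "j < ?k" "(B *\<^sub>v row (c div ?k)) $ j \<noteq> 0"
    using nonzero_vec_index B(2) mult_mat_vec_carrier[OF Bc row] by metis
  \<comment> \<open>Column \<open>j\<close> of \<open>V\<close> times the transpose of
    \<open>B\<close>. The choice of \<open>j\<close> makes its entry at \<open>c div ?k\<close>
    nonzero.\<close>
  define w where "w = vec ?n (\<lambda>a. (B *\<^sub>v row a) $ j)"
  have "w $ (c div ?k) \<noteq> 0" using j(2) a by (simp add: w_def)
  then have "w \<noteq> 0\<^sub>v ?n" using a by auto
  moreover have w: "w \<in> carrier_vec ?n" by (simp add: w_def)
  ultimately have "\<exists>S. (\<forall>l<m. S l \<in> F l) \<and> kronecker_prod m S *\<^sub>v w \<noteq> 0\<^sub>v ?n"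
    by (intro Suc.IH) (blast intro: Suc.prems(1,2) less_SucI)+
  then obtain S where S: "\<forall>l<m. S l \<in> F l" "kronecker_prod m S *\<^sub>v w \<noteq> 0\<^sub>v ?n" by blast
  have Sc: "kronecker_prod m S \<in> carrier_mat ?n ?n"
    using S(1) by (intro kronecker_prod_carrier) (blast intro: Suc.prems(1) less_SucI)
  obtain i where i: "i < ?n" "(kronecker_prod m S *\<^sub>v w) $ i \<noteq> 0"
    using nonzero_vec_index S(2) mult_mat_vec_carrier[OF Sc w] by metis
  \<comment> \<open>The update at \<open>m\<close> leaves the first \<open>m\<close> factors
    untouched.\<close>
  let ?T = "S(m := B)"
  have T: "kronecker_prod (Suc m) ?T = kronecker (kronecker_prod m S) B"
    using kronecker_prod_cong[of m ?T S] by simp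
  have "(kronecker_prod (Suc m) ?T *\<^sub>v v) $ (i * ?k + j) = (kronecker_prod m S *\<^sub>v w) $ i"
    unfolding T w_def row_def using Sc Bc v i(1) j(1) by (rule index_kronecker_mult_vec)
  then have "kronecker_prod (Suc m) ?T *\<^sub>v v \<noteq> 0\<^sub>v (?n * ?k)"
    using i mult_add_less[OF i(1) j(1)] by auto
  moreover have "\<forall>l<Suc m. ?T l \<in> F l" using S(1) B(1) by (auto simp: less_Suc_eq)
  ultimately show ?case by (metis prod.lessThan_Suc)
qed

section \<open>Mirror points\<close>

lemma finite_mirror_points: "finite (mirror_points \<theta>)"
proof -
  let ?n = "dim_vec \<theta>"
  have "mirror_points \<theta> \<subseteq> (\<lambda>e. \<theta> + pi \<cdot>\<^sub>v vec ?n e) ` ({..<?n} \<rightarrow>\<^sub>E {0, 1})"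
  proof
    fix \<xi> assume "\<xi> \<in> mirror_points \<theta>"
    then obtain \<eta> where \<eta>: "\<xi> = \<theta> + pi \<cdot>\<^sub>v \<eta>" "\<eta> \<in> carrier_vec ?n" "\<forall>l<?n. \<eta> $ l \<in> {0, 1}"
      by (auto simp: mirror_points_def)
    \<comment> \<open>Restriction makes the coordinate function of \<open>\<eta>\<close>
      extensional, hence a member of the finite function space.\<close>
    have "\<eta> = vec ?n (restrict (($) \<eta>) {..<?n})" using \<eta>(2) by (intro eq_vecI) auto
    moreover have "restrict (($) \<eta>) {..<?n} \<in> {..<?n} \<rightarrow>\<^sub>E {0, 1}" using \<eta>(3) by auto
    ultimately show "\<xi> \<in> (\<lambda>e. \<theta> + pi \<cdot>\<^sub>v vec ?n e) ` ({..<?n} \<rightarrow>\<^sub>E {0, 1})"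
      unfolding \<eta>(1) by (metis (no_types, lifting) image_eqI)
  qed
  then show ?thesis by (rule finite_subset) (auto intro: finite_PiE)
qed

lemma mirror_pointsI:
  assumes "dim_vec \<xi> = dim_vec \<theta>" and "\<And>l. l < dim_vec \<theta> \<Longrightarrow> \<xi> $ l \<in> {\<theta> $ l, \<theta> $ l + pi}"
  shows "\<xi> \<in> mirror_points \<theta>"
proof -
  let ?\<eta> = "vec (dim_vec \<theta>) (\<lambda>l. if \<xi> $ l = \<theta> $ l then 0 else 1)"
  have "\<xi> = \<theta> + pi \<cdot>\<^sub>v ?\<eta>" using assms by (intro eq_vecI) auto
  moreover have "?\<eta> \<in> carrier_vec (dim_vec \<theta>)" "\<forall>l<dim_vec \<theta>. ?\<eta> $ l \<in> {0, 1}" by auto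
  ultimately show ?thesis unfolding mirror_points_def by blast
qed

lemma matrix_trig_poly_carrier:
  assumes "matrix_trig_poly r p"
  shows "p \<theta> \<in> carrier_mat r r"
proof -
  obtain c :: nat and a :: "int \<Rightarrow> complex mat" where "\<And>k. a k \<in> carrier_mat r r"
    "p \<theta> = finsum_mat r (\<lambda>k. cis (of_int k * \<theta>) \<cdot>\<^sub>m a k) {- int c..int c}"
    using assms by (auto simp: matrix_trig_poly_def)
  then show ?thesis by (auto intro!: finsum_mat_closed)
qed

theorem lemma6p2:
  fixes m :: nat and r :: "nat \<Rightarrow> nat" and p :: "nat \<Rightarrow> real \<Rightarrow> complex mat"
  assumes "m \<ge> 1"
    and "\<And>l. l < m \<Longrightarrow> matrix_trig_poly (r l) (p l)"
    and "\<And>l \<theta>. l < m \<Longrightarrow> \<theta> \<in> {0..<2 * pi} \<Longrightarrow>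
           pos_def_mat (mat_adjoint (p l \<theta>) * p l \<theta> + mat_adjoint (p l (\<theta> + pi)) * p l (\<theta> + pi))"
  shows "\<forall>\<theta> \<in> carrier_vec m. (\<forall>l < m. \<theta> $ l \<in> {0..<2 * pi}) \<longrightarrow>
           pos_def_mat (finsum_mat (\<Prod>l<m. r l)
             (\<lambda>\<xi>. mat_adjoint (multi_symbol m p \<xi>) * multi_symbol m p \<xi>) (mirror_points \<theta>))"
proof (intro ballI impI)
  fix \<theta> :: "real vec"
  assume \<theta>: "\<theta> \<in> carrier_vec m" and range: "\<forall>l<m. \<theta> $ l \<in> {0..<2 * pi}"
  let ?N = "\<Prod>l<m. r l"
  have p: "p l x \<in> carrier_mat (r l) (r l)" if "l < m" for l x
    using assms(2)[OF that] by (rule matrix_trig_poly_carrier)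
  show "pos_def_mat (finsum_mat ?N
      (\<lambda>\<xi>. mat_adjoint (multi_symbol m p \<xi>) * multi_symbol m p \<xi>) (mirror_points \<theta>))"
  proof (rule pos_def_finsum_gram[OF finite_mirror_points])
    show "multi_symbol m p \<xi> \<in> carrier_mat ?N ?N" for \<xi>
      unfolding multi_symbol_def using p by (rule kronecker_prod_carrier)
    fix v :: "complex vec" assume v: "v \<in> carrier_vec ?N" "v \<noteq> 0\<^sub>v ?N"
    \<comment> \<open>The two values of factor \<open>l\<close> over the mirror points of
      \<open>\<theta>\<close>.\<close>
    let ?F = "\<lambda>l. {p l (\<theta> $ l), p l (\<theta> $ l + pi)}"
    have "\<exists>S. (\<forall>l<m. S l \<in> ?F l) \<and> kronecker_prod m S *\<^sub>v v \<noteq> 0\<^sub>v ?N"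
    proof (rule kronecker_prod_choice_nonzero[OF _ _ v])
      show "\<exists>A\<in>?F l. A *\<^sub>v x \<noteq> 0\<^sub>v (r l)"
        if "l < m" "x \<in> carrier_vec (r l)" "x \<noteq> 0\<^sub>v (r l)" for l x
        \<comment> \<open>Positivity at \<open>\<theta> $ l\<close>, which \<open>range\<close>
          places in the required interval, excludes a common kernel vector of the two
          values.\<close>
        using pos_def_gram_add_inj[OF assms(3) p p that(2,3)] that(1) range by blast
    qed (use p in auto)
    then obtain S where S: "\<forall>l<m. S l \<in> ?F l" "kronecker_prod m S *\<^sub>v v \<noteq> 0\<^sub>v ?N" by blast
    \<comment> \<open>\<open>S\<close> selects matrices, not points. The mirror point is recovered
      by comparing values; if both candidates coincide, the unshifted coordinate serves equally
      well.\<close>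
    define \<xi> where
      "\<xi> = vec m (\<lambda>l. if S l = p l (\<theta> $ l) then \<theta> $ l else \<theta> $ l + pi)"
    have "\<xi> \<in> mirror_points \<theta>" using \<theta> by (intro mirror_pointsI) (auto simp: \<xi>_def)
    moreover have "multi_symbol m p \<xi> = kronecker_prod m S"
      unfolding multi_symbol_def using S(1) by (intro kronecker_prod_cong) (auto simp: \<xi>_def)
    ultimately show "\<exists>\<xi>\<in>mirror_points \<theta>. multi_symbol m p \<xi> *\<^sub>v v \<noteq> 0\<^sub>v ?N"
      using S(2) by (intro bexI[of _ \<xi>]) simp_all
  qed
qed

end
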